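(* For every prime $p$ and every integer $n\ge0$, $c_p^{(3)}(n)\,c_p^{(3)}(n+p)\ge 0$; that is, $c_p^{(3)}(n)$ and $c_p^{(3)}(n+p)$ have the same sign.
   Context: For a prime $p$, the coefficients $c_p^{(3)}(n)$ are defined by $\prod_{n\ge1}\frac{(1-q^n)^3}{(1-q^{pn})^3}=\sum_{n\ge0}c_p^{(3)}(n)q^n$. *)

theory Defs
  imports
    "HOL-Analysis.Analysis"
    "HOL-Computational_Algebra.Primes"
    "HOL-Computational_Algebra.Formal_Power_Series"
begin

(* Indices are shifted: cubic_factor p n is the factor of index n + 1 in the product over n \<ge> 1. *)
definition cubic_factor :: "nat \<Rightarrow> nat \<Rightarrow> real fps" where
  "cubic_factor p n = (1 - fps_X ^ Suc n) ^ 3 / (1 - fps_X ^ (p * Suc n)) ^ 3"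

(* The infinite product is the one of the library, taken in the X-adic (coefficientwise)
   topology of formal power series.  cubic_factor_has_prod below shows that it converges,
   and c3_eq_finite_prod that its coefficients are the expected ones.  Coefficients are
   real because division of formal power series needs a field. *)
definition c3 :: "nat \<Rightarrow> nat \<Rightarrow> real" where
  "c3 p n = fps_nth (\<Prod>k. cubic_factor p k) n"

lemma fps_X_power_dvd_nth_eq:
  fixes f g :: "real fps"
  assumes "fps_X ^ m dvd f - g" "k < m"
  shows "fps_nth f k = fps_nth g k"
proof -
  from assms obtain h where "f - g = fps_X ^ m * h" by (elim dvdE)
  then have "fps_nth (f - g) k = 0"
    using assms(2) by (simp only: fps_X_power_mult_nth) simp
  then show ?thesis by simp
qed

lemma X_dvd_one_minus_cubed:
  assumes "m \<le> j"
  shows "(fps_X :: real fps) ^ m dvd (1 - fps_X ^ j) ^ 3 - 1"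
proof -
  have "(1 - fps_X ^ j :: real fps) ^ 3 - 1 =
      fps_X ^ j * (- 3 + 3 * fps_X ^ j - fps_X ^ j * fps_X ^ j)"
    by (simp add: power3_eq_cube algebra_simps)
  moreover have "(fps_X :: real fps) ^ m dvd fps_X ^ j"
    using assms by (rule le_imp_power_dvd)
  ultimately show ?thesis by (simp only: dvd_mult2)
qed

lemma cubic_factor_dvd:
  assumes "p > 0"
  shows "fps_X ^ Suc n dvd cubic_factor p n - 1"
proof -
  define A B :: "real fps"
    where "A = (1 - fps_X ^ Suc n) ^ 3" and "B = (1 - fps_X ^ (p * Suc n)) ^ 3"
  have B0: "fps_nth B 0 \<noteq> 0"
  proof -
    have "p * Suc n \<noteq> 0" using assms by simp
    then show ?thesis by (simp add: B_def fps_power_zeroth power_0_left del: mult_Suc_right)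
  qed
  have "cubic_factor p n = A * inverse B"
    using B0 by (simp add: cubic_factor_def A_def B_def fps_divide_unit)
  moreover have "((A - 1) - (B - 1)) * inverse B = A * inverse B - B * inverse B"
    by (simp only: left_diff_distrib [symmetric] diff_diff_eq2 diff_add_cancel)
  ultimately have eq: "cubic_factor p n - 1 = ((A - 1) - (B - 1)) * inverse B"
    by (simp only: inverse_mult_eq_1'[OF B0])
  have "1 * Suc n \<le> p * Suc n"
    using assms by (intro mult_le_mono1) simp
  then have "fps_X ^ Suc n dvd A - 1" "fps_X ^ Suc n dvd B - 1"
    unfolding A_def B_def by (simp_all only: X_dvd_one_minus_cubed order_refl mult_1)
  then show ?thesis unfolding eq by (rule dvd_mult2[OF dvd_diff])
qed

lemma cubic_factor_partial_stable:
  assumes "p > 0" "k \<le> n"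
  shows "fps_nth (\<Prod>i\<le>n. cubic_factor p i) k = fps_nth (\<Prod>i\<le>k. cubic_factor p i) k"
  using assms(2)
proof (induction n rule: dec_induct)
  case (step n)
  have "(\<Prod>i\<le>Suc n. cubic_factor p i) - (\<Prod>i\<le>n. cubic_factor p i) =
      (\<Prod>i\<le>n. cubic_factor p i) * (cubic_factor p (Suc n) - 1)"
    by (simp only: prod.atMost_Suc right_diff_distrib mult_1_right)
  then have "fps_X ^ Suc (Suc n) dvd
      (\<Prod>i\<le>Suc n. cubic_factor p i) - (\<Prod>i\<le>n. cubic_factor p i)"
    by (simp only: dvd_mult[OF cubic_factor_dvd[OF assms(1), of "Suc n"]])
  from fps_X_power_dvd_nth_eq[OF this, of k] step show ?case by simp
qed simp

lemma cubic_factor_has_prod: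
  assumes "p > 0"
  shows "cubic_factor p has_prod
    Abs_fps (\<lambda>k. fps_nth (\<Prod>i\<le>k. cubic_factor p i) k)" (is "_ has_prod ?F")
proof -
  have "(\<lambda>n. \<Prod>i\<le>n. cubic_factor p i) \<longlonglongrightarrow> ?F"
  proof (rule tendsto_fpsI)
    fix k
    show "\<forall>\<^sub>F n in sequentially. fps_nth (\<Prod>i\<le>n. cubic_factor p i) k = fps_nth ?F k"
      using eventually_ge_at_top[of k]
      by eventually_elim (unfold fps_nth_Abs_fps, rule cubic_factor_partial_stable[OF assms])
  qed
  moreover have "fps_nth ?F 0 = 1"
    using fps_X_power_dvd_nth_eq[OF cubic_factor_dvd[OF assms, of 0], of 0] by simp
  then have "?F \<noteq> 0" by (auto simp del: fps_nth_Abs_fps)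
  ultimately show ?thesis by (simp add: has_prod_def raw_has_prod_def)
qed

lemma c3_eq_finite_prod:
  assumes "p > 0" "n \<le> N"
  shows "c3 p n = fps_nth (\<Prod>k\<le>N. cubic_factor p k) n"
proof -
  have "c3 p n = fps_nth (\<Prod>i\<le>n. cubic_factor p i) n"
    unfolding c3_def has_prod_unique[OF cubic_factor_has_prod[OF assms(1)], symmetric]
    by (rule fps_nth_Abs_fps)
  then show ?thesis using cubic_factor_partial_stable[OF assms] by simp
qed

end

theory Submission
  imports Defs
begin

text \<open>
  For odd \<open>p\<close>, let \<open>J(q) = \<Prod>(1 - q^n)^3\<close>, so that the generating function is
  \<open>J(q) / J(q^p)\<close>.  By Jacobi, \<open>J\<close> is the sum of \<open>(-1)^k (2 k + 1) q^(k (k + 1) / 2)\<close>.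
  Collecting exponents in one residue class modulo \<open>p\<close> and writing \<open>X = q^p\<close> leaves, up to a
  constant and a power of \<open>X\<close>, a series \<open>theta p b\<close> with \<open>0 \<le> 2 b < p\<close>, to be divided by \<open>J(X)\<close>.
  For \<open>b = 0\<close> it is \<open>-2 p J(X^p)\<close>.  For \<open>b > 0\<close> it is a logarithmic derivative of the
  triple product, hence the product of the factors \<open>1 - X^i\<close> over \<open>i \<equiv> 0, b, -b (mod p)\<close> times
  \<open>2 b - p\<close> minus \<open>2 p\<close> times a difference of Lambert series.  One factor \<open>1 / \<Prod>(1 - X^n)\<close>
  absorbs the product, and a factor \<open>1 / (1 - X)\<close> of a second one turns the Lambert series into
  partial sums of a constant sign.  For \<open>p = 2\<close> the generating function is
  \<open>\<Prod>(1 - q^(2 n - 1))^3\<close>, whose coefficients alternate in sign.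
\<close>

section \<open>Truncated and nonnegative power series\<close>

text \<open>Congruence modulo \<open>fps_X ^ K\<close>. It lets finite products and sums of
  sufficient length stand for the infinite ones, so that no limits occur below.\<close>

definition eqX :: "nat \<Rightarrow> real fps \<Rightarrow> real fps \<Rightarrow> bool" where
  "eqX K f g \<longleftrightarrow> (\<forall>k<K. fps_nth f k = fps_nth g k)"

lemma eqX_refl [simp]: "eqX K f f"
  by (simp add: eqX_def)

lemma eqX_sym: "eqX K f g \<Longrightarrow> eqX K g f"
  by (simp add: eqX_def)

lemma eqX_trans [trans]: "eqX K f g \<Longrightarrow> eqX K g h \<Longrightarrow> eqX K f h"
  by (simp add: eqX_def)

lemma eqX_mult: "eqX K f f' \<Longrightarrow> eqX K g g' \<Longrightarrow> eqX K (f * g) (f' * g')"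
  unfolding eqX_def fps_mult_nth by (auto intro!: sum.cong)

lemma eqX_sum: "(\<And>i. i \<in> A \<Longrightarrow> eqX K (f i) (g i)) \<Longrightarrow> eqX K (sum f A) (sum g A)"
  unfolding eqX_def by (auto simp: fps_sum_nth intro!: sum.cong)

lemma eqX_X_power_0: "K \<le> m \<Longrightarrow> eqX K (fps_X ^ m * f) 0"
  by (simp add: eqX_def fps_X_power_mult_nth)

lemma eqX_1_minus_X_power: "K \<le> m \<Longrightarrow> eqX K (1 - fps_X ^ m) 1"
  by (auto simp: eqX_def)

lemma eqX_cancel:
  assumes "eqX K (u * f) (u * g)" "fps_nth u 0 \<noteq> 0"
  shows "eqX K f g"
proof -
  have "eqX K (inverse u * (u * f)) (inverse u * (u * g))"
    by (rule eqX_mult[OF eqX_refl assms(1)])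
  then show ?thesis
    by (simp only: mult.assoc [symmetric] inverse_mult_eq_1[OF assms(2)] mult_1)
qed

definition nonneg :: "real fps \<Rightarrow> bool" where
  "nonneg f \<longleftrightarrow> (\<forall>k. 0 \<le> fps_nth f k)"

lemma nonneg_1 [simp]: "nonneg 1"
  by (simp add: nonneg_def)

lemma nonneg_add: "nonneg f \<Longrightarrow> nonneg g \<Longrightarrow> nonneg (f + g)"
  by (simp add: nonneg_def)

lemma nonneg_mult: "nonneg f \<Longrightarrow> nonneg g \<Longrightarrow> nonneg (f * g)"
  unfolding nonneg_def by (auto simp: fps_mult_nth intro!: sum_nonneg)

lemma nonneg_sum: "(\<And>i. i \<in> A \<Longrightarrow> nonneg (f i)) \<Longrightarrow> nonneg (sum f A)"
  unfolding nonneg_def by (auto simp: fps_sum_nth intro!: sum_nonneg)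

lemma nonneg_power: "nonneg f \<Longrightarrow> nonneg (f ^ n)"
  by (induction n) (auto intro: nonneg_mult)

lemma inverse_1_minus_X_power:
  assumes "c > 0"
  shows "inverse (1 - fps_X ^ c :: real fps) = Abs_fps (\<lambda>k. if c dvd k then 1 else 0)"
    (is "_ = ?S")
proof -
  have "(1 - fps_X ^ c) * ?S = 1"
  proof (rule fps_ext)
    fix k
    show "fps_nth ((1 - fps_X ^ c) * ?S) k = fps_nth 1 k"
      using assms by (auto simp: left_diff_distrib fps_X_power_mult_nth dvd_minus_self
          dest: dvd_imp_le)
  qed
  then show ?thesis by (metis fps_inverse_unique)
qed

lemma nonneg_inverse_1_minus_X_power: "c > 0 \<Longrightarrow> nonneg (inverse (1 - fps_X ^ c))"
  by (simp add: inverse_1_minus_X_power nonneg_def)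

section \<open>The finite triple product identity\<close>

text \<open>The Gaussian binomial coefficient, given by the q-Pascal rule so that it makes sense
  without division.\<close>

fun gbinom :: "'a::comm_ring_1 \<Rightarrow> nat \<Rightarrow> nat \<Rightarrow> 'a" where
  "gbinom q n 0 = 1"
| "gbinom q 0 (Suc k) = 0"
| "gbinom q (Suc n) (Suc k) = gbinom q n k + q ^ Suc k * gbinom q n (Suc k)"

definition qpoch :: "'a::comm_ring_1 \<Rightarrow> nat \<Rightarrow> 'a" where
  "qpoch q n = (\<Prod>i<n. 1 - q ^ Suc i)"

lemma qpoch_0 [simp]: "qpoch q 0 = 1"
  by (simp add: qpoch_def)

lemma qpoch_Suc: "qpoch q (Suc n) = qpoch q n * (1 - q ^ Suc n)"
  by (simp add: qpoch_def)

lemma gbinom_eq_0: "n < k \<Longrightarrow> gbinom q n k = 0"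
  by (induction q n k rule: gbinom.induct) auto

lemma gbinom_self: "gbinom q n n = 1"
  by (induction n) (auto simp: gbinom_eq_0)

text \<open>The quotient formula for Gaussian binomials, free of division. The induction splits
  \<open>1 - q ^ (k + l)\<close> as \<open>(1 - q ^ k) + q ^ k * (1 - q ^ l)\<close>, which matches
  the two terms of the q-Pascal rule.\<close>

lemma gbinom_qpoch: "gbinom q (k + l) k * (qpoch q k * qpoch q l) = qpoch q (k + l)"
proof (induction "k + l" arbitrary: k l)
  case (Suc n)
  show ?case
  proof (cases k; cases l)
    fix k' l' assume kl: "k = Suc k'" "l = Suc l'"
    have 1: "gbinom q (k' + l) k' * (qpoch q k' * qpoch q l) = qpoch q n"
      using Suc.hyps(1)[of k' l] Suc.hyps(2) kl by simp
    have 2: "gbinom q (k + l') k * (qpoch q k * qpoch q l') = qpoch q n"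
      using Suc.hyps(1)[of k l'] Suc.hyps(2) kl by simp
    have "gbinom q (k + l) k * (qpoch q k * qpoch q l) =
        (1 - q ^ k) * (gbinom q (k' + l) k' * (qpoch q k' * qpoch q l)) +
        q ^ k * (1 - q ^ l) * (gbinom q (k + l') k * (qpoch q k * qpoch q l'))"
      using kl by (simp add: qpoch_Suc algebra_simps)
    also have "\<dots> = (1 - q ^ (k + l)) * qpoch q n"
      unfolding 1 2 by (simp add: algebra_simps power_add)
    also have "\<dots> = qpoch q (k + l)"
      using Suc.hyps(2) by (metis qpoch_Suc mult.commute)
    finally show ?thesis .
  qed (auto simp: gbinom_self)
qed simp

lemma coeff_linear_mult:
  "coeff ([:y, x:] * P) 0 = y * coeff P 0"
  "coeff ([:y, x:] * P) (Suc k) = y * coeff P (Suc k) + x * coeff P k"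
  by (simp_all add: coeff_pCons)

text \<open>The q-binomial theorem in homogeneous form. Splitting off the factor
  \<open>j = 0\<close> leaves the same product with \<open>x * q\<close> for \<open>x\<close>, hence
  the induction with \<open>x\<close> arbitrary.\<close>

lemma qbinomial:
  fixes q x y :: "'a::idom"
  shows "coeff (\<Prod>j<N. [:y, x * q ^ j:]) k = q ^ (k choose 2) * gbinom q N k * x ^ k * y ^ (N - k)"
proof (induction N arbitrary: x k)
  case 0
  then show ?case by (cases k) (auto simp: choose_two)
next
  case (Suc N)
  have *: "(\<Prod>j<Suc N. [:y, x * q ^ j:]) = [:y, x:] * (\<Prod>j<N. [:y, x * q * q ^ j:])"
    by (subst prod.lessThan_Suc_shift) (simp add: mult.assoc)
  show ?case
  proof (cases k)
    case 0
    then show ?thesis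
      unfolding * by (simp add: coeff_linear_mult Suc.IH del: mult_pCons_left)
  next
    case (Suc k')
    have ch: "Suc k' choose 2 = k' + (k' choose 2)"
      by (simp add: numeral_2_eq_2)
    \<comment> \<open>For \<open>k' >= N\<close> the truncated exponents do not match, but then the
      Gaussian binomial is zero.\<close>
    have y: "y * (gbinom q N (Suc k') * y ^ (N - Suc k')) = gbinom q N (Suc k') * y ^ (N - k')"
    proof (cases "k' < N")
      case True
      then have "N - k' = Suc (N - Suc k')" by simp
      then show ?thesis by simp
    qed (simp add: gbinom_eq_0)
    have "coeff (\<Prod>j<Suc N. [:y, x * q ^ j:]) k =
       y * (q ^ (Suc k' choose 2) * gbinom q N (Suc k') * (x * q) ^ Suc k' * y ^ (N - Suc k'))
       + x * (q ^ (k' choose 2) * gbinom q N k' * (x * q) ^ k' * y ^ (N - k'))"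
      unfolding * Suc coeff_linear_mult Suc.IH ..
    also have "\<dots> = q ^ (Suc k' choose 2) * (x * q) ^ Suc k'
        * (y * (gbinom q N (Suc k') * y ^ (N - Suc k')))
       + x * (q ^ (k' choose 2) * gbinom q N k' * (x * q) ^ k' * y ^ (N - k'))"
      by (simp only: mult_ac)
    also have "\<dots> = q ^ (Suc k' choose 2) * gbinom q (Suc N) (Suc k') * x ^ Suc k' * y ^ (Suc N - Suc k')"
      unfolding y ch by (simp add: algebra_simps power_add power_mult_distrib)
    finally show ?thesis unfolding Suc .
  qed
qed

definition tri :: "int \<Rightarrow> int" where
  "tri m = m * (m - 1) div 2"

lemma two_tri: "2 * tri m = m * (m - 1)"
  unfolding tri_def by (rule dvd_mult_div_cancel) auto

lemma prod_const_poly: "(\<Prod>i\<in>A. [:f i:]) = [:\<Prod>i\<in>A. f i:]"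
  by (induction A rule: infinite_finite_induct) (auto simp: one_pCons mult.commute)

text \<open>The finite triple product in the variable \<open>z\<close>, multiplied by
  \<open>z ^ n\<close> to become a polynomial: the second factor is
  \<open>z * (1 - q ^ Suc j / z)\<close>.\<close>

definition tpoly :: "'a::idom \<Rightarrow> nat \<Rightarrow> 'a poly" where
  "tpoly q n = (\<Prod>j<n. [:1, - (q ^ j):] * [:- (q ^ Suc j), 1:])"

lemma two_choose_two: "2 * int (k choose 2) = int k * (int k - 1)"
  using two_tri[of "int k"] 
  by (cases k) (auto simp: choose_two tri_def zdiv_int algebra_simps)

lemma tri_nonneg: "tri m \<ge> 0"
proof -
  have "m * (m - 1) \<ge> 0"
    by (cases "m \<ge> 1") (auto simp: zero_le_mult_iff)
  then show ?thesis using two_tri[of m] by linarith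
qed

text \<open>The finite form of Jacobi's triple product identity. It is the q-binomial theorem for
  \<open>2 * n\<close> factors with \<open>x = -1\<close> and \<open>y = q ^ n\<close>, whose two
  halves are, up to powers of \<open>q\<close> and signs, the two families of factors of
  \<open>tpoly\<close>.\<close>

lemma coeff_tpoly:
  fixes q :: "'a::idom"
  assumes "q \<noteq> 0"
  shows "coeff (tpoly q n) k =
    (-1) ^ (n + k) * q ^ nat (tri (int k - int n)) * gbinom q (2 * n) k"
proof (cases "k \<le> 2 * n")
  case True
  have "(\<Prod>j<n + n. [:q ^ n, - 1 * q ^ j:]) =
     (\<Prod>j<n. [:q ^ n, - (q ^ j):]) * (\<Prod>j<n. [:q ^ n, - (q ^ (n + j)):])"
    using prod.atLeastLessThan_concat[of 0 n "n + n" "\<lambda>j. [:q ^ n, - (q ^ j):]"]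
      prod.shift_bounds_nat_ivl[of "\<lambda>j. [:q ^ n, - (q ^ j):]" 0 n n]
    by (simp add: atLeast0LessThan add.commute)
  \<comment> \<open>Reversing the order of the lower half lets \<open>- (q ^ (n - Suc j))\<close> be
    taken out of each factor, leaving \<open>z - q ^ Suc j\<close>.\<close>
  also have "(\<Prod>j<n. [:q ^ n, - (q ^ j):]) = (\<Prod>j<n. [:q ^ n, - (q ^ (n - Suc j)):])"
    by (rule prod.nat_diff_reindex [symmetric])
  also have "\<dots> = (\<Prod>j<n. [:- (q ^ (n - Suc j)):] * [:- (q ^ Suc j), 1:])"
    by (intro prod.cong refl) (auto simp flip: power_add power_Suc)
  also have "\<dots> = [:\<Prod>j<n. - (q ^ (n - Suc j)):] * (\<Prod>j<n. [:- (q ^ Suc j), 1:])"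
    by (simp only: prod.distrib prod_const_poly)
  also have "(\<Prod>j<n. - (q ^ (n - Suc j))) = (\<Prod>j<n. - (q ^ j))"
    by (rule prod.nat_diff_reindex)
  also have "\<dots> = (- 1) ^ n * q ^ (\<Sum>j<n. j)"
    by (simp add: prod_uminus power_sum)
  also have "(\<Prod>j<n. [:q ^ n, - (q ^ (n + j)):]) = (\<Prod>j<n. [:q ^ n:] * [:1, - (q ^ j):])"
    by (intro prod.cong refl) (auto simp: power_add)
  also have "\<dots> = [:\<Prod>j<n. q ^ n:] * (\<Prod>j<n. [:1, - (q ^ j):])"
    by (simp only: prod.distrib prod_const_poly)
  also have "(\<Prod>j<n. q ^ n) = q ^ (n * n)"
    by (simp add: power_mult)
  finally have P: "(\<Prod>j<2 * n. [:q ^ n, - 1 * q ^ j:]) =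
     smult ((- 1) ^ n * q ^ ((\<Sum>j<n. j) + n * n)) (tpoly q n)"
    unfolding tpoly_def prod.distrib mult_2 by (simp add: power_add mult_ac)
  have s: "2 * int (\<Sum>j<n. j) = int n * (int n - 1)"
    by (induction n) (auto simp: algebra_simps)
  \<comment> \<open>The exponents of \<open>q\<close> on both sides agree; they are compared after
    doubling, which clears the halves in the triangular numbers.\<close>
  have "2 * ((\<Sum>j<n. int j) + int n * int n + tri (int k - int n)) = 
      2 * (int (k choose 2) + int n * (2 * int n - int k))"
    using s two_tri[of "int k - int n"] two_choose_two[of k] by (simp add: algebra_simps)
  then have "int ((\<Sum>j<n. j) + n * n + nat (tri (int k - int n))) = 
      int ((k choose 2) + n * (2 * n - k))"
    using True by (simp add: tri_nonneg of_nat_diff)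
  then have ex: "(\<Sum>j<n. j) + n * n + nat (tri (int k - int n)) = (k choose 2) + n * (2 * n - k)"
    by (simp only: of_nat_eq_iff)
  have "(- 1) ^ n * q ^ ((\<Sum>j<n. j) + n * n) * coeff (tpoly q n) k =
     q ^ (k choose 2) * gbinom q (2 * n) k * (- 1) ^ k * (q ^ n) ^ (2 * n - k)"
    using arg_cong[OF P, of "\<lambda>p. coeff p k"] unfolding qbinomial by simp
  also have "\<dots> = q ^ ((k choose 2) + n * (2 * n - k)) * (- 1) ^ k * gbinom q (2 * n) k"
    by (simp add: power_add power_mult mult_ac)
  also have "\<dots> = (- 1) ^ n * q ^ ((\<Sum>j<n. j) + n * n) *
     ((- 1) ^ (n + k) * q ^ nat (tri (int k - int n)) * gbinom q (2 * n) k)"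
    unfolding ex [symmetric] by (simp add: power_add mult_ac)
  finally show ?thesis
    by (rule mult_left_cancel [THEN iffD1, rotated]) (use assms in auto)
next
  case False
  have "degree (tpoly q n) \<le> (\<Sum>j<n. degree ([:1, - (q ^ j):] * [:- (q ^ Suc j), 1:]))"
    unfolding tpoly_def by (rule order.trans[OF degree_prod_sum_le]) (auto simp: o_def)
  also have "\<dots> \<le> (\<Sum>j<n. 2)"
    by (intro sum_mono order.trans[OF degree_mult_le]) auto
  finally have "degree (tpoly q n) \<le> 2 * n" by simp
  with False show ?thesis by (simp add: coeff_eq_0 gbinom_eq_0)
qed


section \<open>Theta series\<close>

text \<open>For \<open>p = 2 * h + 1\<close> and \<open>d = b - h\<close> this is
  \<open>(tri (d + p * m) - tri d) / p\<close>, the exponent left after dissection; see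
  \<open>tri_shift\<close>.\<close>

definition expo :: "nat \<Rightarrow> nat \<Rightarrow> int \<Rightarrow> int" where
  "expo p b m = int p * tri m + int b * m"

text \<open>For \<open>p = 2 * h + 1\<close> and \<open>d = b - h\<close> the linear factor is
  \<open>2 * (d + p * m) - 1\<close>, Jacobi's weight at \<open>d + p * m\<close>; see
  \<open>wt_shift\<close>.\<close>

definition wt :: "nat \<Rightarrow> nat \<Rightarrow> int \<Rightarrow> int" where
  "wt p b m = (if even m then 1 else - 1) * (2 * int b + int p * (2 * m - 1))"

text \<open>\<open>theta 1 0\<close> is \<open>-2\<close> times Jacobi's series for the cube of \<open>\<Prod>(1 - X^n)\<close>: every
  term is counted twice because of the symmetry \<open>m \<mapsto> 1 - m\<close>.\<close>

definition theta :: "nat \<Rightarrow> nat \<Rightarrow> real fps" where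
  "theta p b = Abs_fps (\<lambda>s. \<Sum>m | expo p b m = int s. of_int (wt p b m))"

text \<open>Gives finiteness: only finitely many \<open>m\<close> stay below a given exponent. For
  \<open>m = - k\<close> twice the exponent is \<open>p * k^2 + (p - 2 * b) * k\<close>, where
  \<open>2 * b < p\<close> keeps the linear term nonnegative.\<close>

lemma expo_ge:
  assumes "2 * b < p"
  shows "\<bar>m\<bar> - 1 \<le> expo p b m"
proof (cases "m \<ge> 1")
  case True
  have "0 \<le> (m - 1) * (m - 2)"
    using True by (cases "m = 1") auto
  then have "m - 1 \<le> tri m"
    using two_tri[of m] by (simp add: algebra_simps)
  moreover have "1 * tri m \<le> int p * tri m"
    using assms tri_nonneg[of m] by (intro mult_right_mono) auto
  moreover have "0 \<le> int b * m" using True by simp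
  ultimately show ?thesis using True unfolding expo_def by linarith
next
  case False
  define k where "k = - m"
  have k: "k \<ge> 0" "m = - k" using False by (auto simp: k_def)
  have "2 * int b * k \<le> (int p - 1) * k"
    using assms k by (intro mult_right_mono) auto
  moreover have "1 * (k * k) \<le> int p * (k * k)"
    using assms by (intro mult_right_mono) auto
  moreover have "k \<le> k * k"
    using k by (cases "k = 0") auto
  moreover have "2 * expo p b m = int p * (2 * tri m) + 2 * (int b * m)"
    by (simp add: expo_def)
  then have "2 * expo p b m = int p * (k * k) + int p * k - 2 * int b * k"
    unfolding two_tri k(2) by (simp add: algebra_simps)
  ultimately show ?thesis using k by (simp add: algebra_simps)
qed

lemma expo_nonneg: "2 * b < p \<Longrightarrow> 0 \<le> expo p b m"
  using expo_ge[of b p m] by (cases "m = 0") (auto simp: expo_def tri_def)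

text \<open>Terms of exponent at least \<open>K\<close> are invisible modulo
  \<open>fps_X ^ K\<close>, so any finite index set that covers the smaller exponents will
  do.\<close>

lemma eqX_theta:
  fixes f :: "'i \<Rightarrow> int"
  assumes "2 * b < p" "finite A" "inj_on f A" "{m. expo p b m < int K} \<subseteq> f ` A"
  shows "eqX K (theta p b)
    (\<Sum>i\<in>A. fps_const (of_int (wt p b (f i))) * fps_X ^ nat (expo p b (f i)))"
    (is "eqX K _ (sum ?t A)")
proof -
  have t: "fps_nth (?t i) k = (if expo p b (f i) = int k then of_int (wt p b (f i)) else 0)"
    for i k
    using expo_nonneg[OF assms(1), of "f i"] by (auto simp: fps_X_power_nth)
  have "fps_nth (theta p b) k = fps_nth (sum ?t A) k" if "k < K" for k
  proof -
    have "{m. expo p b m = int k} = {m \<in> f ` A. expo p b m = int k}"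
      using assms(4) that by auto
    then have "fps_nth (theta p b) k = (\<Sum>m\<in>{m \<in> f ` A. expo p b m = int k}. of_int (wt p b m))"
      by (simp add: theta_def)
    also have "\<dots> = (\<Sum>m\<in>f ` A. if expo p b m = int k then of_int (wt p b m) else 0)"
      using assms(2) by (subst sum.inter_filter) auto
    also have "\<dots> = (\<Sum>i\<in>A. fps_nth (?t i) k)"
      unfolding t by (simp add: sum.reindex[OF assms(3)])
    finally show ?thesis by (simp add: fps_sum_nth)
  qed
  then show ?thesis by (simp add: eqX_def)
qed

lemma qpoch_nth_0: "p > 0 \<Longrightarrow> fps_nth (qpoch (fps_X ^ p :: real fps) n) 0 = 1"
  by (induction n) (simp_all add: qpoch_Suc flip: power_mult)

lemma eqX_qpoch:
  assumes "p > 0" "K \<le> n"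
  shows "eqX K (qpoch (fps_X ^ p) n) (qpoch (fps_X ^ p) K)"
  using assms(2)
proof (induction n rule: dec_induct)
  case (step n)
  have "K \<le> 1 * Suc n"
    using step.hyps by simp
  also have "\<dots> \<le> p * Suc n"
    using assms(1) by (intro mult_right_mono) auto
  finally have "K \<le> p * Suc n" .
  then have "eqX K (1 - (fps_X ^ p) ^ Suc n) 1"
    unfolding power_mult [symmetric] by (rule eqX_1_minus_X_power)
  from eqX_mult[OF step.IH this] show ?case by (simp add: qpoch_Suc)
qed simp

lemma eqX_qpoch':
  "p > 0 \<Longrightarrow> K \<le> n \<Longrightarrow> K \<le> m \<Longrightarrow> eqX K (qpoch (fps_X ^ p) n) (qpoch (fps_X ^ p) m)"
  by (rule eqX_trans[OF eqX_qpoch eqX_sym[OF eqX_qpoch]])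

text \<open>In \<open>gbinom_qpoch\<close> all the q-Pochhammer products are congruent once their
  lengths reach \<open>K\<close>, and one of them can be cancelled.\<close>

lemma eqX_gbinom:
  assumes "p > 0" "K \<le> k" "K \<le> l" "K \<le> n"
  shows "eqX K (gbinom (fps_X ^ p) (k + l) k * qpoch (fps_X ^ p) n) 1"
proof (rule eqX_cancel)
  let ?Q = "qpoch (fps_X ^ p :: real fps)"
  show "fps_nth (?Q n) 0 \<noteq> 0" by (simp add: qpoch_nth_0 assms)
  have "eqX K (gbinom (fps_X ^ p) (k + l) k * (?Q n * ?Q n))
      (gbinom (fps_X ^ p) (k + l) k * (?Q k * ?Q l))"
    using assms by (intro eqX_mult eqX_qpoch' eqX_refl) auto
  also have "\<dots> = ?Q (k + l)" by (rule gbinom_qpoch)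
  also have "eqX K \<dots> (?Q n)" using assms by (intro eqX_qpoch') auto
  finally show "eqX K (?Q n * (gbinom (fps_X ^ p) (k + l) k * ?Q n)) (?Q n * 1)"
    by (simp add: mult_ac)
qed

section \<open>Finite theta sums approximating the theta series\<close>

definition theta_sum :: "nat \<Rightarrow> nat \<Rightarrow> nat \<Rightarrow> real fps" where
  "theta_sum p b n = (\<Sum>k\<le>2*n. fps_const (of_int (wt p b (int k - int n))) *
     fps_X ^ nat (expo p b (int k - int n)) * gbinom (fps_X ^ p) (2 * n) k)"

text \<open>Either the exponent is at least \<open>K\<close> and the term vanishes, or the index
  \<open>k - n\<close> is at most \<open>K\<close> in absolute value. In the latter case
  \<open>2 * K <= n\<close> keeps \<open>k\<close> at distance at least \<open>K\<close> from both
  \<open>0\<close> and \<open>2 * n\<close>, so \<open>eqX_gbinom\<close> applies.\<close>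

lemma eqX_theta_sum:
  assumes "2 * b < p" "2 * K \<le> n"
  shows "eqX K (theta p b) (theta_sum p b n * qpoch (fps_X ^ p) n)"
proof -
  have "{m. expo p b m < int K} \<subseteq> (\<lambda>k. int k - int n) ` {..2*n}"
  proof
    fix m assume "m \<in> {m. expo p b m < int K}"
    then have "\<bar>m\<bar> - 1 < int K" using expo_ge[OF assms(1), of m] by simp
    then have "m = int (nat (m + int n)) - int n" "nat (m + int n) \<le> 2 * n"
      using assms(2) by linarith+
    then show "m \<in> (\<lambda>k. int k - int n) ` {..2*n}" by blast
  qed
  then have "eqX K (theta p b) (\<Sum>k\<le>2*n. fps_const (of_int (wt p b (int k - int n))) *
     fps_X ^ nat (expo p b (int k - int n)))"
    using assms by (intro eqX_theta) (auto simp: inj_on_def)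
  also have "eqX K \<dots> (\<Sum>k\<le>2*n. fps_const (of_int (wt p b (int k - int n))) *
     (fps_X ^ nat (expo p b (int k - int n)) * (gbinom (fps_X ^ p) (2 * n) k * qpoch (fps_X ^ p) n)))"
  proof (intro eqX_sum eqX_mult eqX_refl)
    fix k assume k: "k \<in> {..2*n}"
    let ?e = "expo p b (int k - int n)"
    show "eqX K (fps_X ^ nat ?e)
      (fps_X ^ nat ?e * (gbinom (fps_X ^ p) (2 * n) k * qpoch (fps_X ^ p) n))"
    proof (cases "?e \<ge> int K")
      case True
      then have "K \<le> nat ?e" by linarith
      from eqX_X_power_0[OF this, of 1] eqX_X_power_0[OF this] show ?thesis
        by (metis eqX_sym eqX_trans mult_1_right)
    next
      case False
      then have "\<bar>int k - int n\<bar> \<le> int K"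
        using expo_ge[OF assms(1), of "int k - int n"] by linarith
      then have "K \<le> k" "K \<le> 2 * n - k" "k + (2 * n - k) = 2 * n"
        using assms(2) k by auto
      with eqX_gbinom[of p K k "2 * n - k" n] assms
      have "eqX K (gbinom (fps_X ^ p) (2 * n) k * qpoch (fps_X ^ p) n) 1"
        by simp
      from eqX_mult[OF eqX_refl this, of "fps_X ^ nat ?e"] show ?thesis
        by (simp add: eqX_sym)
    qed
  qed
  finally show ?thesis
    by (simp add: theta_sum_def sum_distrib_right mult.assoc)
qed

lemma poly_sum_atMost:
  fixes P :: "'a::idom poly"
  assumes "\<And>k. k > N \<Longrightarrow> coeff P k = 0"
  shows "poly P z = (\<Sum>k\<le>N. coeff P k * z ^ k)"
proof -
  have "degree P \<le> N" using assms by (intro degree_le) auto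
  then show ?thesis
    unfolding poly_altdef
    by (intro sum.mono_neutral_left) (auto simp: coeff_eq_0)
qed

lemma poly_pderiv_sum_atMost:
  fixes P :: "'a::idom poly"
  assumes "\<And>k. k > N \<Longrightarrow> coeff P k = 0"
  shows "z * poly (pderiv P) z = (\<Sum>k\<le>N. of_nat k * (coeff P k * z ^ k))"
proof -
  have "z * poly (pderiv P) z = poly (pCons 0 (pderiv P)) z" by simp
  also have "\<dots> = (\<Sum>k\<le>N. coeff (pCons 0 (pderiv P)) k * z ^ k)"
    using assms by (intro poly_sum_atMost) (auto simp: coeff_pCons coeff_pderiv split: nat.splits)
  also have "\<dots> = (\<Sum>k\<le>N. of_nat k * (coeff P k * z ^ k))"
    by (intro sum.cong refl) (auto simp: coeff_pCons coeff_pderiv split: nat.splits)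
  finally show ?thesis .
qed

text \<open>The linear weight in \<open>m\<close> comes from the operator \<open>z d/dz\<close>, evaluated at
  \<open>q = X ^ p\<close>, \<open>z = X ^ b\<close>.\<close>

lemma theta_sum_eq:
  fixes p b n :: nat
  defines "P \<equiv> tpoly (fps_X ^ p :: real fps) n" and "z \<equiv> fps_X ^ b"
  assumes "2 * b < p"
  shows "fps_X ^ (b * n) * theta_sum p b n =
     of_nat (2 * b) * poly P z +
     of_nat p * (2 * (z * poly (pderiv P) z - of_nat n * poly P z) - poly P z)"
proof -
  have 0: "coeff P k = 0" if "k > 2 * n" for k
    using that unfolding P_def by (simp add: coeff_tpoly gbinom_eq_0)
  then have P: "poly P z = (\<Sum>k\<le>2*n. coeff P k * z ^ k)"
    by (rule poly_sum_atMost)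
  from 0 have P': "z * poly (pderiv P) z = (\<Sum>k\<le>2*n. of_nat k * (coeff P k * z ^ k))"
    by (rule poly_pderiv_sum_atMost)
  \<comment> \<open>The index is \<open>m = k - n\<close>, so \<open>expo\<close> contributes
    \<open>b * (k - n)\<close> where \<open>z ^ k\<close> contributes \<open>b * k\<close>; the
    factor \<open>fps_X ^ (b * n)\<close> makes up the difference.\<close>
  have c: "of_int (wt p b (int k - int n)) * (fps_X ^ (b * n) * 
      (fps_X ^ nat (expo p b (int k - int n)) * gbinom (fps_X ^ p) (2 * n) k)) =
     (of_nat (2 * b) + of_nat p * (2 * (of_nat k - of_nat n) - 1)) * (coeff P k * z ^ k)" for k
  proof -
    have "int (b * n + nat (expo p b (int k - int n))) = 
       int (p * nat (tri (int k - int n)) + b * k)"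
      using expo_nonneg[OF assms(3), of "int k - int n"] tri_nonneg[of "int k - int n"]
      by (simp add: expo_def algebra_simps)
    then have "b * n + nat (expo p b (int k - int n)) = p * nat (tri (int k - int n)) + b * k"
      by (simp only: of_nat_eq_iff)
    then have e: "fps_X ^ (b * n) * fps_X ^ nat (expo p b (int k - int n)) =
       (fps_X ^ p) ^ nat (tri (int k - int n)) * (z ^ k :: real fps)"
      unfolding z_def power_mult [symmetric] power_add [symmetric] by simp
    have w: "of_int (wt p b (int k - int n)) = (- 1) ^ (n + k) *
       (of_nat (2 * b) + of_nat p * (2 * (of_nat k - of_nat n) - 1) :: real fps)"
      by (auto simp: wt_def minus_one_power_iff)
    have P: "coeff P k = (- 1) ^ (n + k) * (fps_X ^ p) ^ nat (tri (int k - int n)) *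
        gbinom (fps_X ^ p) (2 * n) k"
      unfolding P_def by (rule coeff_tpoly) simp
    have "of_int (wt p b (int k - int n)) * (fps_X ^ (b * n) * 
      (fps_X ^ nat (expo p b (int k - int n)) * gbinom (fps_X ^ p) (2 * n) k)) =
      of_int (wt p b (int k - int n)) * ((fps_X ^ (b * n) * 
      fps_X ^ nat (expo p b (int k - int n))) * gbinom (fps_X ^ p) (2 * n) k)"
      by (simp only: mult.assoc)
    also have "\<dots> = (of_nat (2 * b) + of_nat p * (2 * (of_nat k - of_nat n) - 1)) *
        (coeff P k * z ^ k)"
      unfolding e w P by (simp only: mult_ac)
    finally show ?thesis .
  qed
  have "fps_X ^ (b * n) * theta_sum p b n = (\<Sum>k\<le>2*n.
     (of_nat (2 * b) + of_nat p * (2 * (of_nat k - of_nat n) - 1)) * (coeff P k * z ^ k))"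
    unfolding theta_sum_def sum_distrib_left
    by (intro sum.cong refl) (subst c [symmetric], simp add: fps_of_int mult_ac)
  also have "\<dots> = of_nat (2 * b) * poly P z +
     of_nat p * (2 * (z * poly (pderiv P) z - of_nat n * poly P z) - poly P z)"
    unfolding P' P sum_distrib_left sum_subtractf [symmetric] sum.distrib [symmetric]
    by (intro sum.cong refl) (simp add: algebra_simps)
  finally show ?thesis .
qed

text \<open>Additivity of logarithmic derivatives, with \<open>L j\<close> in the role of
  \<open>z * F' / F\<close> for the factor \<open>F j\<close>.\<close>

lemma poly_pderiv_prod:
  fixes F :: "nat \<Rightarrow> 'a::idom poly"
  assumes "\<And>j. j < n \<Longrightarrow> z * poly (pderiv (F j)) z = poly (F j) z * L j"
  shows "z * poly (pderiv (\<Prod>j<n. F j)) z = poly (\<Prod>j<n. F j) z * (\<Sum>j<n. L j)"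
  using assms
proof (induction n)
  case (Suc n)
  have "z * poly (pderiv (\<Prod>j<Suc n. F j)) z =
      poly (\<Prod>j<n. F j) z * (z * poly (pderiv (F n)) z) +
      poly (F n) z * (z * poly (pderiv (\<Prod>j<n. F j)) z)"
    by (simp add: pderiv_mult algebra_simps)
  also have "\<dots> = poly (\<Prod>j<Suc n. F j) z * (\<Sum>j<Suc n. L j)"
    using Suc by (simp add: algebra_simps)
  finally show ?case .
qed simp

section \<open>Lambert series and the evaluation of the finite theta sums\<close>

definition lambert :: "nat \<Rightarrow> real fps" where
  "lambert c = fps_X ^ c * inverse (1 - fps_X ^ c)"

lemma lambert_mult: "c > 0 \<Longrightarrow> (1 - fps_X ^ c) * lambert c = fps_X ^ c"
  using inverse_mult_eq_1[of "1 - fps_X ^ c :: real fps"]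
  by (simp add: lambert_def mult.commute mult.left_commute)

definition theta_prod :: "nat \<Rightarrow> nat \<Rightarrow> nat \<Rightarrow> real fps" where
  "theta_prod p b n = (\<Prod>j<n. (1 - fps_X ^ (b + p * j)) * (1 - fps_X ^ (p * Suc j - b)))"

text \<open>At \<open>z = fps_X ^ b\<close> no factor of the triple product vanishes. The pair of
  factors with index \<open>j\<close> has logarithmic derivative
  \<open>1 + lambert d - lambert c\<close>, where \<open>c = b + p * j\<close> and
  \<open>d = p * Suc j - b\<close>; the ones add up to \<open>n\<close> and cancel the
  \<open>n\<close> of \<open>theta_sum_eq\<close>.\<close>

lemma theta_sum_pos:
  assumes "0 < b" "2 * b < p"
  shows "theta_sum p b n = theta_prod p b n * (of_nat (2 * b) +
    of_nat p * (2 * (\<Sum>j<n. lambert (p * Suc j - b) - lambert (b + p * j)) - 1))"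
proof -
  define q z :: "real fps" where "q = fps_X ^ p" and "z = fps_X ^ b"
  define F where "F = (\<lambda>j. [:1, - (q ^ j):] * [:- (q ^ Suc j), 1:])"
  have F: "poly (F j) z = z * ((1 - fps_X ^ (b + p * j)) * (1 - fps_X ^ (p * Suc j - b)))"
    and F': "z * poly (pderiv (F j)) z =
      poly (F j) z * (1 + (lambert (p * Suc j - b) - lambert (b + p * j)))" for j
  proof -
    define c d where "c = b + p * j" and "d = p * Suc j - b"
    have cd: "c > 0" "d > 0" using assms by (auto simp: c_def d_def)
    have zq: "z * q ^ j = fps_X ^ c"
      by (simp add: z_def q_def c_def power_add power_mult)
    have "b + d = p * Suc j" using assms by (auto simp: d_def)
    then have qd: "q ^ Suc j = z * fps_X ^ d"
      unfolding z_def q_def power_mult [symmetric] power_add [symmetric] by simp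
    have 1: "poly [:1, - (q ^ j):] z = 1 - fps_X ^ c"
      using zq by simp
    have 2: "poly [:- (q ^ Suc j), 1:] z = z * (1 - fps_X ^ d)"
      unfolding qd by (simp add: algebra_simps)
    show "poly (F j) z = z * ((1 - fps_X ^ (b + p * j)) * (1 - fps_X ^ (p * Suc j - b)))"
      unfolding F_def poly_mult 1 2 c_def [symmetric] d_def [symmetric] by (simp only: mult_ac)
    have "z * poly (pderiv (F j)) z =
       (1 - fps_X ^ c) * z - z * (1 - fps_X ^ d) * (z * q ^ j)"
      unfolding F_def pderiv_mult poly_add poly_mult 1 2 by (simp add: pderiv_pCons algebra_simps)
    also have "\<dots> = (1 - fps_X ^ c) * z - z * (1 - fps_X ^ d) * ((1 - fps_X ^ c) * lambert c)"
      unfolding zq lambert_mult[OF cd(1)] ..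
    \<comment> \<open>Inserting \<open>(1 - fps_X ^ d) * (1 + lambert d) = 1\<close> makes both
      terms multiples of \<open>poly (F j) z\<close>.\<close>
    also have "(1 - fps_X ^ c) * z = (1 - fps_X ^ c) * z * ((1 - fps_X ^ d) + (1 - fps_X ^ d) * lambert d)"
      unfolding lambert_mult[OF cd(2)] by simp
    also have "\<dots> - z * (1 - fps_X ^ d) * ((1 - fps_X ^ c) * lambert c) =
        poly (F j) z * (1 + (lambert d - lambert c))"
      unfolding F_def poly_mult 1 2 by (simp add: algebra_simps)
    finally show "z * poly (pderiv (F j)) z =
        poly (F j) z * (1 + (lambert (p * Suc j - b) - lambert (b + p * j)))"
      unfolding c_def d_def .
  qed
  have P: "tpoly q n = (\<Prod>j<n. F j)" by (simp add: tpoly_def F_def)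
  have P1: "poly (tpoly q n) z = fps_X ^ (b * n) * theta_prod p b n"
    unfolding P poly_prod F theta_prod_def prod.distrib
    by (simp add: z_def power_mult)
  define S where "S = (\<Sum>j<n. lambert (p * Suc j - b) - lambert (b + p * j))"
  have "z * poly (pderiv (tpoly q n)) z = poly (tpoly q n) z *
      (\<Sum>j<n. 1 + (lambert (p * Suc j - b) - lambert (b + p * j)))"
    unfolding P by (rule poly_pderiv_prod) (rule F')
  also have "(\<Sum>j<n. 1 + (lambert (p * Suc j - b) - lambert (b + p * j))) = of_nat n + S"
    unfolding sum.distrib S_def by simp
  finally have P2: "z * poly (pderiv (tpoly q n)) z = poly (tpoly q n) z * (of_nat n + S)" .
  have "fps_X ^ (b * n) * theta_sum p b n =
     poly (tpoly q n) z * (of_nat (2 * b) + of_nat p * (2 * S - 1))"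
    unfolding theta_sum_eq[OF assms(2)] q_def [symmetric] z_def [symmetric] P2
    by (simp add: algebra_simps)
  then have "fps_X ^ (b * n) * theta_sum p b n =
     fps_X ^ (b * n) * (theta_prod p b n * (of_nat (2 * b) + of_nat p * (2 * S - 1)))"
    unfolding P1 by (simp only: mult.assoc)
  then show ?thesis unfolding S_def by simp
qed

text \<open>At \<open>z = 1\<close> the factor \<open>1 - z\<close> vanishes. The value of the
  product is therefore zero, and its derivative is minus the product \<open>R\<close> of the other
  factors.\<close>

lemma theta_sum_0:
  assumes "0 < p"
  shows "theta_sum p 0 (Suc m) =
    - (of_nat (2 * p) * (qpoch (fps_X ^ p) (Suc m) * qpoch (fps_X ^ p) m))"
proof -
  define q :: "real fps" where "q = fps_X ^ p"
  define R where "R = [:- q, 1:] * (\<Prod>j<m. [:1, - (q ^ Suc j):] * [:- (q ^ Suc (Suc j)), 1:])"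
  have P: "tpoly q (Suc m) = [:1, - 1:] * R"
    unfolding tpoly_def R_def prod.lessThan_Suc_shift by (simp only: power_0 power_Suc0_right mult.assoc)
  have "poly R 1 = (1 - q) * (\<Prod>j<m. (1 - q ^ Suc j) * (1 - q ^ Suc (Suc j)))"
    unfolding R_def poly_mult poly_prod by (simp add: algebra_simps)
  also have "\<dots> = qpoch q (Suc m) * qpoch q m"
    unfolding prod.distrib qpoch_def by (subst prod.lessThan_Suc_shift) (simp add: mult_ac)
  finally have R: "poly R 1 = qpoch q (Suc m) * qpoch q m" .
  have "poly (pderiv (tpoly q (Suc m))) 1 = - poly R 1"
    unfolding P pderiv_mult poly_add poly_mult by (simp add: pderiv_pCons)
  moreover have "poly (tpoly q (Suc m)) 1 = 0"
    unfolding P poly_mult by simp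
  ultimately show ?thesis
    using theta_sum_eq[of 0 p "Suc m"] assms R by (simp add: q_def mult.assoc)
qed

text \<open>Jacobi's identity for the cube, in powers of \<open>fps_X ^ p\<close>: two of the three
  factors come from \<open>theta_sum_0\<close>, the third from \<open>eqX_theta_sum\<close>.\<close>

lemma eqX_theta_0:
  assumes "0 < p" "2 * K \<le> n" "0 < K"
  shows "eqX K (theta p 0) (- (of_nat (2 * p) * qpoch (fps_X ^ p) n ^ 3))"
proof -
  from assms obtain m where m: "n = Suc m" "K \<le> m" by (cases n) auto
  have "eqX K (theta p 0) (theta_sum p 0 n * qpoch (fps_X ^ p) n)"
    using assms by (intro eqX_theta_sum) auto
  also have "\<dots> = (- of_nat (2 * p) * qpoch (fps_X ^ p) n ^ 2) * qpoch (fps_X ^ p) m"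
    unfolding m theta_sum_0[OF assms(1)] by (simp add: power2_eq_square)
  also have "eqX K \<dots> ((- of_nat (2 * p) * qpoch (fps_X ^ p) n ^ 2) * qpoch (fps_X ^ p) n)"
    using assms m by (intro eqX_mult[OF eqX_refl] eqX_qpoch') auto
  finally show ?thesis by (simp add: power3_eq_cube power2_eq_square mult.assoc)
qed

section \<open>Sign of the theta series\<close>

lemma lambert_div: "c > 0 \<Longrightarrow> lambert c * inverse (1 - fps_X) = Abs_fps (\<lambda>k. real (k div c))"
  (is "_ \<Longrightarrow> _ = ?S")
proof -
  assume c: "c > 0"
  have "(1 - fps_X) * ?S = lambert c"
  proof (rule fps_ext)
    fix k
    show "fps_nth ((1 - fps_X) * ?S) k = fps_nth (lambert c) k"
    proof (cases k)
      case 0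
      then show ?thesis using c by (simp add: lambert_def)
    next
      case (Suc k')
      have "fps_nth (lambert c) k = (if c dvd k then 1 else 0)"
        using c Suc unfolding lambert_def inverse_1_minus_X_power[OF c]
        by (auto simp: fps_X_power_mult_nth dvd_minus_self dest: dvd_imp_le)
      moreover have "fps_nth ((1 - fps_X) * ?S) k = real (Suc k' div c) - real (k' div c)"
        using Suc by (simp add: left_diff_distrib)
      ultimately show ?thesis
        using Suc by (simp add: div_Suc dvd_eq_mod_eq_0)
    qed
  qed
  then have "lambert c * inverse (1 - fps_X) = (inverse (1 - fps_X) * (1 - fps_X)) * ?S"
    by (metis mult.assoc mult.commute)
  also have "inverse (1 - fps_X) * (1 - fps_X :: real fps) = 1"
    by (rule inverse_mult_eq_1) simp
  finally show ?thesis by simp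
qed

text \<open>Multiplying by \<open>1 / (1 - X)\<close> passes to partial sums, which are counted by \<open>k div c\<close>
  and hence decrease with \<open>c\<close>; the coefficients of \<open>lambert c - lambert d\<close> themselves have no fixed sign.\<close>

lemma nonneg_lambert_diff:
  assumes "0 < c" "c \<le> d"
  shows "nonneg ((lambert c - lambert d) * inverse (1 - fps_X))"
  using assms by (simp add: left_diff_distrib lambert_div nonneg_def div_le_mono2)

lemma prod_1_minus_X_power_nth_0:
  "0 \<notin> A \<Longrightarrow> fps_nth (\<Prod>i\<in>A. 1 - fps_X ^ i :: real fps) 0 = 1"
  by (induction A rule: infinite_finite_induct) auto

lemma nonneg_inverse_prod:
  assumes "0 \<notin> A"
  shows "nonneg (inverse (\<Prod>i\<in>A. 1 - fps_X ^ i))"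
  using assms
  by (induction A rule: infinite_finite_induct)
    (auto simp: fps_inverse_mult intro!: nonneg_mult nonneg_inverse_1_minus_X_power)

text \<open>The exponents in \<open>A\<close> are distinct and at most \<open>M\<close>, so their
  factors cancel. What remains is a product of geometric series, which has nonnegative
  coefficients.\<close>

lemma prod_div_qpoch:
  assumes "A \<subseteq> {1..M}"
  shows "(\<Prod>i\<in>A. 1 - fps_X ^ i) * inverse (qpoch fps_X M) =
    inverse (\<Prod>i\<in>{1..M} - A. 1 - fps_X ^ i :: real fps)"
proof -
  have "qpoch fps_X M = (\<Prod>i\<in>{1..M}. 1 - fps_X ^ i :: real fps)"
    unfolding qpoch_def
    by (rule prod.reindex_bij_witness[of _ "\<lambda>i. i - 1" Suc]) auto
  also have "\<dots> = (\<Prod>i\<in>{1..M} - A. 1 - fps_X ^ i) * (\<Prod>i\<in>A. 1 - fps_X ^ i)"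
    by (rule prod.subset_diff) (use assms in auto)
  finally have "(\<Prod>i\<in>A. 1 - fps_X ^ i) * inverse (qpoch fps_X M) =
      inverse (\<Prod>i\<in>{1..M} - A. 1 - fps_X ^ i :: real fps) *
      (inverse (\<Prod>i\<in>A. 1 - fps_X ^ i) * (\<Prod>i\<in>A. 1 - fps_X ^ i))"
    by (simp only: fps_inverse_mult mult_ac)
  also have "inverse (\<Prod>i\<in>A. 1 - fps_X ^ i) * (\<Prod>i\<in>A. 1 - fps_X ^ i :: real fps) = 1"
    using assms by (intro inverse_mult_eq_1) (subst prod_1_minus_X_power_nth_0, auto)
  finally show ?thesis by simp
qed

lemma nonneg_prod_div_qpoch:
  "A \<subseteq> {1..M} \<Longrightarrow> nonneg ((\<Prod>i\<in>A. 1 - fps_X ^ i) * inverse (qpoch fps_X M))"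
  unfolding prod_div_qpoch by (rule nonneg_inverse_prod) auto

lemma mult_Suc_in: "j < n \<Longrightarrow> 0 < p \<Longrightarrow> p * Suc j \<in> {1..p * n}"
  using mult_le_mono2[of "Suc j" n p] by auto

lemma qpoch_X_power:
  assumes "0 < p"
  shows "qpoch (fps_X ^ p) n = (\<Prod>i\<in>(\<lambda>j. p * Suc j) ` {..<n}. 1 - fps_X ^ i :: real fps)"
  using assms unfolding qpoch_def power_mult [symmetric]
  by (subst prod.reindex) (auto simp: inj_on_def)

lemma nonneg_qpoch_div:
  assumes "0 < p"
  shows "nonneg (qpoch (fps_X ^ p) n * inverse (qpoch fps_X (p * n)))"
  unfolding qpoch_X_power[OF assms] using mult_Suc_in[OF _ assms]
  by (intro nonneg_prod_div_qpoch) blast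

text \<open>The three families of exponents have the residues \<open>0\<close>, \<open>b\<close> and
  \<open>p - b\<close> modulo \<open>p\<close>, which differ because \<open>0 < 2 * b < p\<close>.
  No exponent repeats, so one reciprocal \<open>qpoch\<close> absorbs the whole product.\<close>

lemma qpoch_theta_prod:
  assumes "0 < b" "2 * b < p"
  obtains A where "A \<subseteq> {1..p * n}"
    "qpoch (fps_X ^ p) n * theta_prod p b n = (\<Prod>i\<in>A. 1 - fps_X ^ i)"
proof -
  define A B C where "A = (\<lambda>j. p * Suc j) ` {..<n}" and "B = (\<lambda>j. b + p * j) ` {..<n}"
    and "C = (\<lambda>j. p * Suc j - b) ` {..<n}"
  have p: "0 < p" using assms by simp
  have le: "b + p * j \<le> p * Suc j" "1 \<le> p * Suc j - b" for j using assms by auto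
  have A: "A \<subseteq> {1..p * n}" using mult_Suc_in[OF _ p] by (auto simp: A_def)
  have B: "B \<subseteq> {1..p * n}"
  proof
    fix x assume "x \<in> B"
    then obtain j where j: "j < n" "x = b + p * j" by (auto simp: B_def)
    then show "x \<in> {1..p * n}"
      using mult_Suc_in[OF j(1) p] le(1)[of j] assms by auto
  qed
  have C: "C \<subseteq> {1..p * n}"
  proof
    fix x assume "x \<in> C"
    then obtain j where j: "j < n" "x = p * Suc j - b" by (auto simp: C_def)
    then show "x \<in> {1..p * n}"
      using mult_Suc_in[OF j(1) p] le(2)[of j] by auto
  qed
  have mA: "x mod p = 0" if "x \<in> A" for x using that by (auto simp: A_def simp del: mult_Suc_right)
  have mB: "x mod p = b" if "x \<in> B" for x using that assms by (auto simp: B_def)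
  have mC: "x mod p = p - b" if "x \<in> C" for x
  proof -
    from that obtain j where "x = p * Suc j - b" by (auto simp: C_def)
    then have x: "x = (p - b) + p * j" using assms by auto
    show ?thesis unfolding x mod_mult_self2 using assms by simp
  qed
  have False if "x \<in> A" "x \<in> B" for x
    using mA[OF that(1)] mB[OF that(2)] assms by simp
  moreover have False if "x \<in> A \<union> B" "x \<in> C" for x
    using that(1) mA[of x] mB[of x] mC[OF that(2)] assms by auto
  ultimately have disj: "A \<inter> B = {}" "(A \<union> B) \<inter> C = {}"
    by blast+
  have "qpoch (fps_X ^ p) n = (\<Prod>i\<in>A. 1 - fps_X ^ i :: real fps)"
    unfolding A_def by (rule qpoch_X_power[OF p])
  moreover have "(\<Prod>j<n. 1 - fps_X ^ (b + p * j)) = (\<Prod>i\<in>B. 1 - fps_X ^ i :: real fps)"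
    unfolding B_def using p by (subst prod.reindex) (auto simp: inj_on_def)
  moreover have "(\<Prod>j<n. 1 - fps_X ^ (p * Suc j - b)) = (\<Prod>i\<in>C. 1 - fps_X ^ i :: real fps)"
  proof -
    have "inj_on (\<lambda>j. p * Suc j - b) {..<n}"
    proof
      fix i j assume "p * Suc i - b = p * Suc j - b"
      then have "p * Suc i = p * Suc j"
        using le(2)[of i] le(2)[of j] by linarith
      then show "i = j" using p by (metis Suc_inject mult_left_cancel not_gr_zero)
    qed
    then show ?thesis unfolding C_def by (subst prod.reindex) auto
  qed
  ultimately have "qpoch (fps_X ^ p) n * theta_prod p b n =
      (\<Prod>i\<in>A. 1 - fps_X ^ i) * (\<Prod>i\<in>B. 1 - fps_X ^ i) * (\<Prod>i\<in>C. 1 - fps_X ^ i :: real fps)"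
    unfolding theta_prod_def prod.distrib by (simp only: mult.assoc)
  also have "\<dots> = (\<Prod>i\<in>A \<union> B \<union> C. 1 - fps_X ^ i)"
    using disj by (simp add: prod.union_disjoint A_def B_def C_def)
  finally show ?thesis using A B C by (intro that[of "A \<union> B \<union> C"]) auto
qed

lemma nonneg_of_nat: "nonneg (of_nat n)"
  by (simp add: nonneg_def fps_of_nat [symmetric])

text \<open>For \<open>b = 0\<close> each of the three reciprocals absorbs one factor of the cube.
  For \<open>b > 0\<close> one absorbs the product over \<open>A\<close>, the second makes the
  Lambert bracket nonnegative, and the third is nonnegative by itself.\<close>

lemma theta_nonpos:
  assumes "2 * b < p" "2 * K \<le> n" "k < K"
  shows "fps_nth (theta p b * inverse (qpoch fps_X (p * n) ^ 3)) k \<le> 0"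
proof -
  define J :: "real fps" where "J = inverse (qpoch fps_X (p * n))"
  have J3: "inverse (qpoch fps_X (p * n) ^ 3) = J * J * J"
    unfolding J_def power3_eq_cube fps_inverse_mult ..
  have p: "0 < p" using assms by simp
  have "\<exists>g. nonneg g \<and> eqX K (theta p b * (J * J * J)) (- g)"
  proof (cases "b = 0")
    case True
    define u where "u = qpoch (fps_X ^ p) n * J"
    have "nonneg u" unfolding u_def J_def by (rule nonneg_qpoch_div[OF p])
    then have "nonneg (of_nat (2 * p) * u ^ 3)"
      by (intro nonneg_mult nonneg_of_nat nonneg_power)
    moreover have "eqX K (theta p b * (J * J * J)) (- (of_nat (2 * p) * qpoch (fps_X ^ p) n ^ 3) * (J * J * J))"
      unfolding True using assms p by (intro eqX_mult[OF eqX_theta_0 eqX_refl]) auto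
    moreover have "- (of_nat (2 * p) * qpoch (fps_X ^ p) n ^ 3) * (J * J * J) = - (of_nat (2 * p) * u ^ 3)"
      unfolding u_def power3_eq_cube by (simp add: mult_ac)
    ultimately show ?thesis by metis
  next
    case False
    then have b: "0 < b" by simp
    define S where "S = (\<Sum>j<n. lambert (b + p * j) - lambert (p * Suc j - b))"
    have S': "(\<Sum>j<n. lambert (p * Suc j - b) - lambert (b + p * j)) = - S"
      unfolding S_def sum_negf [symmetric] by simp
    \<comment> \<open>Minus the bracket of \<open>theta_sum_pos\<close>. Since
      \<open>2 * b < p\<close>, the constant is positive and
      \<open>b + p * j <= p * Suc j - b\<close>, as \<open>nonneg_lambert_diff\<close>
      requires.\<close>
    define B where "B = of_nat (p - 2 * b) + of_nat (2 * p) * S"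
    from qpoch_theta_prod[OF b assms(1)] obtain A where A: "A \<subseteq> {1..p * n}"
      "qpoch (fps_X ^ p) n * theta_prod p b n = (\<Prod>i\<in>A. 1 - fps_X ^ i)" .
    have n: "1 \<le> p * n" using assms p by (simp add: Suc_le_eq)
    \<comment> \<open>\<open>J\<close> is split as \<open>inverse (1 - fps_X)\<close> times
      \<open>(1 - fps_X) * J\<close>: the first makes the Lambert differences nonnegative, and the
      second is still a product of geometric series.\<close>
    have BJ: "nonneg (B * J)"
    proof -
      have I: "inverse (1 - fps_X) * (1 - fps_X :: real fps) = 1"
        by (rule inverse_mult_eq_1) simp
      have "nonneg (S * inverse (1 - fps_X))"
        unfolding S_def sum_distrib_right
        using assms b by (intro nonneg_sum nonneg_lambert_diff) auto
      moreover have "nonneg (inverse (1 - fps_X))"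
        using nonneg_inverse_1_minus_X_power[of 1] by simp
      ultimately have "nonneg (of_nat (p - 2 * b) * inverse (1 - fps_X) +
          of_nat (2 * p) * (S * inverse (1 - fps_X)))"
        by (intro nonneg_add nonneg_mult[OF nonneg_of_nat])
      moreover have "nonneg ((1 - fps_X) * J)"
        using nonneg_prod_div_qpoch[of "{1}" "p * n"] n unfolding J_def by simp
      ultimately have "nonneg ((of_nat (p - 2 * b) * inverse (1 - fps_X) +
          of_nat (2 * p) * (S * inverse (1 - fps_X))) * ((1 - fps_X) * J))"
        by (rule nonneg_mult)
      also have "\<dots> = B * (inverse (1 - fps_X) * (1 - fps_X)) * J"
        unfolding B_def by (simp only: distrib_right mult.assoc)
      finally show ?thesis unfolding I by simp
    qed
    have J: "nonneg J"
      using nonneg_prod_div_qpoch[of "{}" "p * n"] unfolding J_def by simp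
    have "nonneg (((\<Prod>i\<in>A. 1 - fps_X ^ i) * J) * (B * J) * J)"
      using nonneg_prod_div_qpoch[OF A(1)] BJ J unfolding J_def [symmetric]
      by (intro nonneg_mult[OF nonneg_mult])
    moreover have "eqX K (theta p b * (J * J * J)) (theta_sum p b n * qpoch (fps_X ^ p) n * (J * J * J))"
      using assms by (intro eqX_mult[OF eqX_theta_sum eqX_refl]) auto
    moreover have "theta_sum p b n = theta_prod p b n * - B"
      using assms unfolding theta_sum_pos[OF b assms(1)] S' B_def
      by (simp add: of_nat_diff algebra_simps)
    then have "theta_sum p b n * qpoch (fps_X ^ p) n * (J * J * J) =
       - (((\<Prod>i\<in>A. 1 - fps_X ^ i) * J) * (B * J) * J)"
      unfolding A(2) [symmetric] by (simp add: mult_ac)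
    ultimately show ?thesis by metis
  qed
  then show ?thesis
    using assms(3) unfolding J3 by (auto simp: eqX_def nonneg_def)
qed

section \<open>Dissection modulo an odd prime\<close>

lemma tri_reflect: "tri (1 - m) = tri m"
  using two_tri[of m] two_tri[of "1 - m"] by (simp add: algebra_simps)

lemma tri_diff: "2 * (tri m - tri d) = (m - d) * (m - (1 - d))"
  using two_tri[of m] two_tri[of d] by (simp add: algebra_simps)

text \<open>By \<open>tri_diff\<close>, twice the difference is a product of two linear terms, and
  the prime divides one of them.\<close>

lemma tri_cong:
  assumes "prime p" "odd p" "int p dvd tri m - tri d"
  shows "int p dvd m - d \<or> int p dvd m - (1 - d)"
proof -
  have "int p dvd (m - d) * (m - (1 - d))"
    using assms(3) unfolding tri_diff [symmetric] by (rule dvd_mult)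
  then show ?thesis using assms(1) by (simp add: prime_dvd_mult_iff)
qed

text \<open>With \<open>d = b - h\<close> one has \<open>2 * d - 1 = 2 * b - p\<close>, so the term
  of the expansion linear in \<open>l\<close> supplies both \<open>b * l\<close> and the
  \<open>- l\<close> inside \<open>tri l\<close>.\<close>

lemma tri_shift:
  assumes "p = 2 * h + 1"
  shows "tri (int b - int h + int p * l) = tri (int b - int h) + int p * expo p b l"
proof -
  let ?d = "int b - int h"
  have "2 * tri (?d + int p * l) = (?d + int p * l) * (?d + int p * l - 1)"
    by (rule two_tri)
  also have "\<dots> = ?d * (?d - 1) + int p * (int p * (l * (l - 1)) + 2 * int b * l)"
    using assms by (simp add: algebra_simps)
  also have "\<dots> = 2 * (tri ?d + int p * expo p b l)"
    unfolding two_tri [symmetric] expo_def by (simp add: algebra_simps)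
  finally show ?thesis by simp
qed

lemma wt_shift:
  assumes "p = 2 * h + 1"
  shows "wt 1 0 (int b - int h + int p * l) = (if even (int b - int h) then 1 else - 1) * wt p b l"
  using assms by (auto simp: wt_def algebra_simps)

lemma wt_reflect: "wt p 0 (1 - m) = wt p 0 m"
  by (auto simp: wt_def algebra_simps)

lemma expo_1_0: "expo 1 0 m = tri m"
  by (simp add: expo_def)

lemma finite_tri: "finite {m. tri m = N}"
proof (rule finite_subset)
  show "{m. tri m = N} \<subseteq> {- (N + 1)..N + 1}"
  proof
    fix m assume "m \<in> {m. tri m = N}"
    then show "m \<in> {- (N + 1)..N + 1}"
      using expo_ge[of 0 1 m] unfolding expo_1_0 by auto
  qed
qed simp

lemma X_power_theta_nth:
  assumes "2 * b < p"
  shows "fps_nth (fps_X ^ e * theta p b) s =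
    (\<Sum>m | int e + expo p b m = int s. of_int (wt p b m))"
proof (cases "s < e")
  case True
  then have "{m. int e + expo p b m = int s} = {}"
    using expo_nonneg[OF assms] by (smt (verit) Collect_empty_eq of_nat_less_iff)
  then show ?thesis using True by (simp only: fps_X_power_mult_nth) simp
next
  case False
  then have "{m. int e + expo p b m = int s} = {m. expo p b m = int (s - e)}"
    by auto
  then show ?thesis using False by (simp add: fps_X_power_mult_nth theta_def)
qed

text \<open>The solutions of \<open>tri m = r\<close> modulo \<open>p\<close> fill at most the two
  classes of \<open>d\<close> and \<open>1 - d\<close>. The reflection \<open>m\<close> to
  \<open>1 - m\<close> swaps them and keeps exponents and weights, so both contribute the same
  series, a signed shift of \<open>theta p b\<close>.\<close>

lemma theta_dissect:
  assumes "prime p" "odd p" "r < p"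
  obtains c :: int and e b :: nat where "2 * b < p"
    "\<And>s. fps_nth (theta 1 0) (r + p * s) = of_int c * fps_nth (fps_X ^ e * theta p b) s"
proof (cases "\<exists>m. int p dvd tri m - int r")
  case False
  \<comment> \<open>No triangular number lies in this residue class, so the constant is zero and
    \<open>e\<close> and \<open>b\<close> are arbitrary.\<close>
  have "fps_nth (theta 1 0) (r + p * s) = of_int 0 * fps_nth (fps_X ^ 0 * theta p 0) s" for s
  proof -
    have "tri m \<noteq> int (r + p * s)" for m
    proof
      assume "tri m = int (r + p * s)"
      then have "tri m - int r = int p * int s" by simp
      with False show False by (metis dvd_triv_left)
    qed
    then have "{m. expo 1 0 m = int (r + p * s)} = {}"
      unfolding expo_1_0 by blast
    then show ?thesis by (simp add: theta_def)
  qed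
  with assms show ?thesis by (intro that[of 0 0 0]) auto
next
  case True
  then obtain m where m: "int p dvd tri m - int r" ..
  from assms(2) obtain h where h: "p = 2 * h + 1" by (elim oddE)
  \<comment> \<open>Modulo \<open>p\<close> and up to reflection, \<open>m\<close> has a
    representative \<open>b - h\<close> between \<open>- h\<close> and \<open>0\<close>:
    \<open>b\<close> is the residue \<open>t\<close> of \<open>m + h\<close> if
    \<open>t <= h\<close>, and \<open>p - t\<close> after reflection otherwise.\<close>
  have "\<exists>b\<le>h. \<exists>l. m = int b - int h + int p * l \<or> m = 1 - (int b - int h + int p * l)"
  proof -
    define t where "t = (m + int h) mod int p"
    have t: "0 \<le> t" "t < int p" "m + int h = t + int p * ((m + int h) div int p)"
      using assms(3) by (auto simp: t_def)
    show ?thesis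
    proof (cases "t \<le> int h")
      case True
      then show ?thesis using t
        by (intro exI[of _ "nat t"] conjI exI[of _ "(m + int h) div int p"] disjI1) auto
    next
      case False
      have "m = 1 - (int (nat (int p - t)) - int h + int p * - ((m + int h) div int p))"
        using t h by (simp add: algebra_simps)
      moreover have "nat (int p - t) \<le> h"
        using False h by simp
      ultimately show ?thesis by blast
    qed
  qed
  then obtain b l0 where b: "b \<le> h" 
    and "m = int b - int h + int p * l0 \<or> m = 1 - (int b - int h + int p * l0)" by blast
  then have "tri m = tri (int b - int h + int p * l0)"
    by (metis tri_reflect)
  define d where "d = int b - int h"
  have "tri m = tri d + int p * expo p b l0"
    using \<open>tri m = _\<close> unfolding tri_shift[OF h] d_def .
  with m have "int p dvd tri d + int p * expo p b l0 - int r" by simp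
  moreover have "tri d - int r = (tri d + int p * expo p b l0 - int r) - int p * expo p b l0"
    by simp
  ultimately have "int p dvd tri d - int r"
    by (metis dvd_diff dvd_triv_left)
  then obtain e' where e': "tri d - int r = int p * e'" ..
  \<comment> \<open>Otherwise \<open>tri d\<close> would be at most \<open>r - p\<close>, which is
    negative.\<close>
  have "e' \<ge> 0"
  proof (rule ccontr)
    assume "\<not> e' \<ge> 0"
    then have "int p * e' \<le> int p * (- 1)"
      by (intro mult_left_mono) auto
    then show False using e' tri_nonneg[of d] assms(3) by simp
  qed
  then obtain e where e: "tri d = int r + int p * int e"
    using e' by (metis add.commute diff_add_cancel nonneg_int_cases)
  have bp: "2 * b < p" using b h by simp
  define \<sigma> :: int where "\<sigma> = (if even d then 1 else - 1)"
  define W where "W = (\<lambda>m. of_int (wt 1 0 m) :: real)"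
  define S where "S = (\<lambda>s. {m. tri m = int (r + p * s)})"
  define A where "A = (\<lambda>s. {m \<in> S s. int p dvd m - d})"
  define A' where "A' = (\<lambda>s. {m \<in> S s. int p dvd m - (1 - d)})"
  have fin: "finite (S s)" for s unfolding S_def by (rule finite_tri)
  have theta: "fps_nth (theta 1 0) (r + p * s) = sum W (S s)" for s
    unfolding theta_def W_def S_def expo_1_0 by simp
  have SA: "S s = A s \<union> A' s" for s
  proof -
    have "m \<in> A s \<union> A' s" if "m \<in> S s" for m
    proof -
      have "tri m - tri d = int p * (int s - int e)"
        using that e by (simp add: S_def algebra_simps)
      then have "int p dvd tri m - tri d" by simp
      from tri_cong[OF assms(1,2) this] that show ?thesis by (auto simp: A_def A'_def)
    qed
    then show ?thesis by (auto simp: A_def A'_def)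
  qed
  have sumA: "sum W (A s) = of_int \<sigma> * fps_nth (fps_X ^ e * theta p b) s" for s
  proof -
    have p0: "int p \<noteq> 0" using h by simp
    \<comment> \<open>Elements of the class are written \<open>m = d + p * l\<close>;
      \<open>tri_shift\<close> turns the condition on \<open>m\<close> into one on
      \<open>l\<close>.\<close>
    have "sum W (A s) = (\<Sum>l | int e + expo p b l = int s. W (d + int p * l))"
    proof (rule sum.reindex_bij_witness[of _ "\<lambda>l. d + int p * l" "\<lambda>m. (m - d) div int p"])
      fix m assume "m \<in> A s"
      then obtain l where l: "m - d = int p * l" and m: "tri m = int (r + p * s)"
        by (auto simp: A_def S_def)
      have l': "(m - d) div int p = l" using l p0 by simp
      have ml: "m = d + int p * l" using l by simp
      show "d + int p * ((m - d) div int p) = m" unfolding l' by (rule ml [symmetric])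
      then show "W (d + int p * ((m - d) div int p)) = W m" by simp
      have "int p * (int e + expo p b l) = int p * int s"
        using m e unfolding ml unfolding d_def tri_shift[OF h] by (simp add: algebra_simps)
      then show "(m - d) div int p \<in> {l. int e + expo p b l = int s}"
        unfolding l' using p0 by simp
    next
      fix l assume "l \<in> {l. int e + expo p b l = int s}"
      then have l: "int s = int e + expo p b l" by simp
      show "(d + int p * l - d) div int p = l" using p0 by simp
      have "tri (d + int p * l) = int (r + p * s)"
        using e l tri_shift[OF h, of b l] unfolding d_def by (simp add: algebra_simps)
      then show "d + int p * l \<in> A s" by (simp add: A_def S_def)
    qed
    also have "\<dots> = (\<Sum>l | int e + expo p b l = int s. of_int \<sigma> * of_int (wt p b l))"
      unfolding W_def \<sigma>_def d_def wt_shift[OF h] by simp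
    also have "\<dots> = of_int \<sigma> * fps_nth (fps_X ^ e * theta p b) s"
      unfolding X_power_theta_nth[OF bp] sum_distrib_left ..
    finally show ?thesis .
  qed
  have sumA': "sum W (A' s) = sum W (A s)" for s
  proof (rule sum.reindex_bij_witness[of _ "\<lambda>m. 1 - m" "\<lambda>m. 1 - m"])
    fix m assume "m \<in> A' s"
    moreover have "1 - m - d = - (m - (1 - d))" by simp
    ultimately show "1 - m \<in> A s"
      unfolding A_def A'_def S_def by (simp only: mem_Collect_eq tri_reflect dvd_minus_iff)
  next
    fix m assume "m \<in> A s"
    moreover have "1 - m - (1 - d) = - (m - d)" by simp
    ultimately show "1 - m \<in> A' s"
      unfolding A_def A'_def S_def by (simp only: mem_Collect_eq tri_reflect dvd_minus_iff)
  qed (auto simp: W_def wt_reflect)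
  show ?thesis
  proof (cases "b = 0")
    case True
    \<comment> \<open>For \<open>b = 0\<close> the classes of \<open>d\<close> and
      \<open>1 - d\<close> coincide, so the common sum counts only once.\<close>
    have "2 * d - 1 = - int p" using True h by (simp add: d_def)
    then have "m - d = (m - (1 - d)) + int p" "m - (1 - d) = (m - d) - int p" for m
      by simp_all
    then have "int p dvd m - d \<longleftrightarrow> int p dvd m - (1 - d)" for m
      by (metis dvd_add dvd_diff dvd_refl)
    then have "A' s = A s" for s by (auto simp: A_def A'_def)
    then show ?thesis
      using bp theta SA sumA by (intro that[of b \<sigma> e]) auto
  next
    case False
    \<comment> \<open>A common element would make \<open>p\<close> divide \<open>2 * b\<close>,
      which lies strictly between \<open>0\<close> and \<open>p\<close>. The two equal sums
      therefore add, giving the constant \<open>2 * \<sigma>\<close>.\<close>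
    have "A s \<inter> A' s = {}" for s
    proof (rule ccontr)
      assume "A s \<inter> A' s \<noteq> {}"
      then obtain m where "int p dvd m - d" "int p dvd m - (1 - d)"
        by (auto simp: A_def A'_def)
      then have "int p dvd (m - d) - (m - (1 - d)) " by (rule dvd_diff)
      moreover have "(m - d) - (m - (1 - d)) = int p - int (2 * b)"
        using h by (simp add: d_def)
      ultimately have "int p dvd int p - int (2 * b)" by simp
      then have "int p dvd int (2 * b)"
        by (metis dvd_diff dvd_refl diff_diff_eq2 add_diff_cancel_left')
      then show False
        using False bp unfolding int_dvd_int_iff by (auto dest: dvd_imp_le)
    qed
    then have "sum W (S s) = of_int (2 * \<sigma>) * fps_nth (fps_X ^ e * theta p b) s" for s
      unfolding SA using fin[of s] sumA sumA'
      by (subst sum.union_disjoint) (auto simp: A_def A'_def)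
    then show ?thesis
      using bp theta by (intro that[of b "2 * \<sigma>" e]) auto
  qed
qed

section \<open>The coefficients of the cubed product\<close>

lemma prod_cubic_factor:
  assumes "0 < p"
  shows "(\<Prod>k<M. cubic_factor p k) = qpoch fps_X M ^ 3 * inverse (qpoch (fps_X ^ p) M ^ 3)"
proof (induction M)
  case (Suc M)
  have "fps_nth ((1 - fps_X ^ (p * Suc M)) ^ 3 :: real fps) 0 \<noteq> 0"
    using assms by (simp add: fps_power_zeroth power_0_left del: mult_Suc_right)
  then have "cubic_factor p M = (1 - fps_X ^ Suc M) ^ 3 * inverse ((1 - fps_X ^ (p * Suc M)) ^ 3)"
    unfolding cubic_factor_def by (rule fps_divide_unit)
  then show ?case
    unfolding prod.lessThan_Suc Suc.IH qpoch_Suc power_mult_distrib fps_inverse_mult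
    by (simp only: power_mult mult_ac)
qed simp

lemma c3_eq:
  assumes "0 < p" "n < M"
  shows "c3 p n = fps_nth (qpoch fps_X M ^ 3 * inverse (qpoch (fps_X ^ p) M ^ 3)) n"
proof (cases M)
  case (Suc N)
  then show ?thesis
    using c3_eq_finite_prod[of p n N] assms
    by (simp only: prod_cubic_factor [symmetric] lessThan_Suc_atMost less_Suc_eq_le)
qed (use assms in simp)

lemma qpoch_compose:
  assumes "0 < p"
  shows "qpoch (fps_X ^ p) M = qpoch fps_X M oo (fps_X ^ p :: real fps)"
proof -
  have 0: "fps_nth (fps_X ^ p :: real fps) 0 = 0" using assms by simp
  show ?thesis
    unfolding qpoch_def fps_compose_prod_distrib[OF 0] fps_compose_sub_distrib
      fps_compose_power[OF 0, symmetric] fps_X_fps_compose_startby0[OF 0]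
    by simp
qed

lemma compose_X_power_nth:
  assumes "0 < p"
  shows "fps_nth (G oo fps_X ^ p) n = (if p dvd n then fps_nth G (n div p) else (0 :: real))"
proof -
  have "fps_nth (G oo fps_X ^ p) n =
      (\<Sum>i\<in>{0..n}. if i \<in> {i. n = p * i} then fps_nth G i else 0)"
    unfolding fps_compose_nth power_mult [symmetric]
    by (intro sum.cong refl) (simp add: fps_X_power_nth)
  also have "\<dots> = (\<Sum>i\<in>{0..n} \<inter> {i. n = p * i}. fps_nth G i)"
    by (rule sum.inter_restrict [symmetric]) simp
  also have "{0..n} \<inter> {i. n = p * i} = (if p dvd n then {n div p} else {})"
    using assms by auto
  finally show ?thesis by simp
qed

text \<open>Since \<open>G oo fps_X ^ p\<close> has only exponents divisible by \<open>p\<close>,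
  residue classes do not mix, and the dissection of a numerator passes to the quotient.\<close>

lemma mult_compose_X_power_nth:
  assumes "r < p"
  shows "fps_nth (f * (G oo fps_X ^ p)) (r + p * t) =
    (\<Sum>s\<in>{0..t}. fps_nth f (r + p * s) * fps_nth G (t - s) :: real)"
proof -
  have p: "0 < p" using assms by simp
  let ?g = "\<lambda>i. fps_nth f i * fps_nth (G oo fps_X ^ p) (r + p * t - i)"
  have "(\<Sum>s\<in>{0..t}. fps_nth f (r + p * s) * fps_nth G (t - s)) = (\<Sum>s\<in>{0..t}. ?g (r + p * s))"
  proof (intro sum.cong refl)
    fix s assume "s \<in> {0..t}"
    have "r + p * t - (r + p * s) = p * (t - s)" by (simp add: diff_mult_distrib2)
    then show "fps_nth f (r + p * s) * fps_nth G (t - s) = ?g (r + p * s)"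
      using p by (simp add: compose_X_power_nth)
  qed
  also have "\<dots> = sum ?g ((\<lambda>s. r + p * s) ` {0..t})"
    using p by (subst sum.reindex) (auto simp: inj_on_def)
  also have "\<dots> = sum ?g {0..r + p * t}"
  proof (rule sum.mono_neutral_left)
    show "\<forall>i\<in>{0..r + p * t} - (\<lambda>s. r + p * s) ` {0..t}. ?g i = 0"
    proof
      fix i assume i: "i \<in> {0..r + p * t} - (\<lambda>s. r + p * s) ` {0..t}"
      have "\<not> p dvd r + p * t - i"
      proof
        assume "p dvd r + p * t - i"
        then obtain u where "r + p * t - i = p * u" ..
        moreover have "i \<le> r + p * t" using i by simp
        ultimately have u: "r + p * t = i + p * u" by linarith
        have "u \<le> t"
        proof (rule ccontr)
          assume "\<not> u \<le> t"
          then have "p * Suc t \<le> p * u" by (intro mult_le_mono2) simp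
          then show False using u assms by simp
        qed
        then have "p * t = p * (t - u) + p * u"
          by (simp add: distrib_left [symmetric])
        with u have "i = r + p * (t - u)" by simp
        then show False using i by auto
      qed
      then show "?g i = 0" by (simp add: compose_X_power_nth[OF p])
    qed
  qed auto
  finally show ?thesis by (simp add: fps_mult_nth)
qed

text \<open>The indices \<open>n\<close> and \<open>n + p\<close> lie in one residue class and share
  the constant \<open>c\<close>, so the product of the two coefficients is \<open>(c / 2)^2\<close>
  times a product of two nonpositive numbers.\<close>

lemma c3_sign_odd:
  assumes "prime p" "odd p"
  shows "c3 p n * c3 p (n + p) \<ge> 0"
proof -
  have p: "0 < p" using assms(1) by (rule prime_gt_0_nat)
  define r t where "r = n mod p" and "t = n div p"
  have n: "n = r + p * t" "n + p = r + p * Suc t" and r: "r < p"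
    using p by (simp_all add: r_def t_def)
  define K where "K = n + p + 1"
  \<comment> \<open>\<open>K\<close> exceeds both indices. \<open>M\<close> has the shape
    \<open>p * n\<close> of \<open>theta_nonpos\<close> with \<open>2 * K\<close> for
    \<open>n\<close>, and is also long enough for Jacobi's identity modulo
    \<open>fps_X ^ K\<close>.\<close>
  define M where "M = p * (2 * K)"
  define G :: "real fps" where "G = inverse (qpoch fps_X M ^ 3)"
  have M: "2 * K \<le> M" "K \<le> M" using p by (simp_all add: M_def)
  obtain c :: int and e b :: nat where b: "2 * b < p"
    and c: "\<And>s. fps_nth (theta 1 0) (r + p * s) = of_int c * fps_nth (fps_X ^ e * theta p b) s"
    using theta_dissect[OF assms r] by blast
  have Q0: "fps_nth (qpoch fps_X M ^ 3 :: real fps) 0 \<noteq> 0"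
    using qpoch_nth_0[of 1 M] by (simp add: fps_power_zeroth)
  have X0: "fps_nth (fps_X ^ p :: real fps) 0 = 0" using p by simp
  have G: "inverse (qpoch (fps_X ^ p) M ^ 3) = G oo fps_X ^ p"
    unfolding qpoch_compose[OF p] fps_compose_power[OF X0] G_def
    by (rule fps_inverse_compose[OF X0 Q0, symmetric])
  \<comment> \<open>The factor \<open>- 1 / 2\<close> undoes the double counting and the sign in
    \<open>theta 1 0\<close>.\<close>
  have Q: "eqX K (qpoch fps_X M ^ 3) (fps_const (- 1 / 2) * theta 1 0)"
  proof -
    have "eqX K (fps_const (- 1 / 2) * theta 1 0)
        (fps_const (- 1 / 2) * (- (of_nat (2 * 1) * qpoch (fps_X ^ 1) M ^ 3)))"
      using M by (intro eqX_mult[OF eqX_refl] eqX_theta_0) (auto simp: K_def)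
    also have "fps_const (- 1 / 2) * (- (of_nat (2 * 1) * qpoch (fps_X ^ 1) M ^ 3)) =
        (fps_const (- 1 / 2) * - fps_const 2) * qpoch fps_X M ^ 3"
      unfolding numeral_fps_const [symmetric] by (simp add: mult.assoc)
    also have "fps_const (- 1 / 2) * - fps_const (2::real) = 1"
      by simp
    finally show ?thesis by (simp add: eqX_sym)
  qed
  have c3_class: "\<exists>y\<le>0. c3 p (r + p * u) = - (of_int c / 2) * y" if "u \<le> Suc t" for u
  proof -
    have "p * u \<le> p * Suc t" using that by (rule mult_le_mono2)
    then have u: "r + p * u < K" using n(2) by (simp add: K_def)
    moreover have "u \<le> p * u" using p by simp
    ultimately have "u < K" by linarith
    have "c3 p (r + p * u) = fps_nth (qpoch fps_X M ^ 3 * (G oo fps_X ^ p)) (r + p * u)"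
      using u M p by (subst c3_eq[of _ _ M]) (auto simp: G)
    also have "\<dots> = fps_nth (fps_const (- 1 / 2) * theta 1 0 * (G oo fps_X ^ p)) (r + p * u)"
      using eqX_mult[OF Q eqX_refl] u by (simp add: eqX_def)
    also have "\<dots> = (\<Sum>s\<in>{0..u}. - (of_int c / 2) * (fps_nth (fps_X ^ e * theta p b) s * fps_nth G (u - s)))"
      unfolding mult_compose_X_power_nth[OF r] by (intro sum.cong refl) (simp add: c[unfolded One_nat_def])
    also have "\<dots> = - (of_int c / 2) * fps_nth (fps_X ^ e * theta p b * G) u"
      unfolding fps_mult_nth[of "fps_X ^ e * theta p b" G] sum_distrib_left ..
    also have "fps_X ^ e * theta p b * G = fps_X ^ e * (theta p b * G)"
      by (rule mult.assoc)
    finally have "c3 p (r + p * u) = - (of_int c / 2) * fps_nth (fps_X ^ e * (theta p b * G)) u" .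
    \<comment> \<open>For \<open>u < e\<close> the coefficient is zero; otherwise it is the one at
      \<open>u - e\<close>, which is still below \<open>K\<close>.\<close>
    moreover have "fps_nth (fps_X ^ e * (theta p b * G)) u \<le> 0"
      using theta_nonpos[OF b order_refl, of "u - e" K] \<open>u < K\<close>
      by (simp only: fps_X_power_mult_nth) (simp add: G_def M_def)
    ultimately show ?thesis by blast
  qed
  obtain y where y: "y \<le> 0" "c3 p n = - (of_int c / 2) * y"
    using c3_class[of t] unfolding n(1) [symmetric] by auto
  obtain y' where y': "y' \<le> 0" "c3 p (n + p) = - (of_int c / 2) * y'"
    using c3_class[of "Suc t"] unfolding n(2) [symmetric] by auto
  have "c3 p n * c3 p (n + p) = (of_int c / 2)\<^sup>2 * (y * y')"
    unfolding y(2) y'(2) by (simp add: power2_eq_square)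
  also have "\<dots> \<ge> 0"
    using y(1) y'(1) by (intro mult_nonneg_nonneg mult_nonpos_nonpos) auto
  finally show ?thesis .
qed

section \<open>The prime 2: coefficients of alternating sign\<close>

definition alternating :: "real fps \<Rightarrow> bool" where
  "alternating f \<longleftrightarrow> (\<forall>k. 0 \<le> (- 1) ^ k * fps_nth f k)"

lemma alternating_1 [simp]: "alternating 1"
  by (simp add: alternating_def)

lemma alternating_mult:
  assumes "alternating f" "alternating g"
  shows "alternating (f * g)"
  unfolding alternating_def
proof
  have f: "0 \<le> (- 1) ^ i * fps_nth f i" and g: "0 \<le> (- 1) ^ i * fps_nth g i" for i
    using assms by (simp_all add: alternating_def)
  fix k
  have "(- 1) ^ k * fps_nth (f * g) k =
      (\<Sum>i\<in>{0..k}. ((- 1) ^ i * fps_nth f i) * ((- 1) ^ (k - i) * fps_nth g (k - i)))"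
    unfolding fps_mult_nth sum_distrib_left
  proof (intro sum.cong refl)
    fix i assume "i \<in> {0..k}"
    then have "(- 1) ^ k = (- 1) ^ i * (- 1 :: real) ^ (k - i)"
      by (simp flip: power_add)
    then show "(- 1) ^ k * (fps_nth f i * fps_nth g (k - i)) =
        ((- 1) ^ i * fps_nth f i) * ((- 1) ^ (k - i) * fps_nth g (k - i))"
      by simp
  qed
  also have "\<dots> \<ge> 0"
    by (intro sum_nonneg mult_nonneg_nonneg[OF f g])
  finally show "0 \<le> (- 1) ^ k * fps_nth (f * g) k" .
qed

lemma alternating_power: "alternating f \<Longrightarrow> alternating (f ^ n)"
  by (induction n) (auto intro: alternating_mult)

lemma alternating_prod: "(\<And>i. i \<in> A \<Longrightarrow> alternating (f i)) \<Longrightarrow> alternating (prod f A)"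
  by (induction A rule: infinite_finite_induct) (auto intro: alternating_mult)

lemma alternating_inverse_prod:
  "(\<And>i. i \<in> A \<Longrightarrow> alternating (inverse (f i))) \<Longrightarrow> alternating (inverse (prod f A))"
  by (induction A rule: infinite_finite_induct) (auto simp: fps_inverse_mult intro: alternating_mult)

lemma alternating_1_minus_X_power: "odd i \<Longrightarrow> alternating (1 - fps_X ^ i)"
  by (auto simp: alternating_def fps_X_power_nth)

lemma alternating_inverse_1_minus_X_power:
  assumes "even i" "0 < i"
  shows "alternating (inverse (1 - fps_X ^ i))"
proof -
  have "even k" if "i dvd k" for k
    using assms(1) that by (rule dvd_trans)
  then show ?thesis
    using assms(2) by (simp add: alternating_def inverse_1_minus_X_power)
qed

text \<open>The even exponents up to \<open>M\<close> cancel. The numerator keeps odd exponents, the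
  denominator keeps the even ones between \<open>M\<close> and \<open>2 * M\<close>, and both kinds
  of factor are alternating.\<close>

lemma alternating_qpoch_div:
  "alternating (qpoch fps_X M * inverse (qpoch (fps_X ^ 2) M))"
proof -
  define E where "E = (\<lambda>j. 2 * Suc j) ` {..<M}"
  define P where "P = (\<lambda>A. \<Prod>i\<in>A. 1 - fps_X ^ i :: real fps)"
  have "qpoch fps_X M = P {1..M}"
    unfolding qpoch_def P_def
    by (rule prod.reindex_bij_witness[of _ "\<lambda>i. i - 1" Suc]) auto
  also have "\<dots> = P ({1..M} - E) * P ({1..M} \<inter> E)"
    unfolding P_def by (rule prod.Int_Diff[of _ _ E, simplified mult.commute]) simp
  finally have 1: "qpoch fps_X M = P ({1..M} - E) * P ({1..M} \<inter> E)" .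
  have "qpoch (fps_X ^ 2) M = P E"
    unfolding P_def E_def by (rule qpoch_X_power) simp
  also have "\<dots> = P (E - {1..M} \<inter> E) * P ({1..M} \<inter> E)"
    unfolding P_def by (rule prod.subset_diff) (auto simp: E_def)
  also have "E - {1..M} \<inter> E = E - {1..M}" by blast
  finally have 2: "qpoch (fps_X ^ 2) M = P (E - {1..M}) * P ({1..M} \<inter> E)" .
  have "fps_nth (P ({1..M} \<inter> E)) 0 = 1"
    unfolding P_def by (rule prod_1_minus_X_power_nth_0) simp
  then have 3: "inverse (P ({1..M} \<inter> E)) * P ({1..M} \<inter> E) = 1"
    by (intro inverse_mult_eq_1) simp
  have "qpoch fps_X M * inverse (qpoch (fps_X ^ 2) M) = P ({1..M} - E) *
      inverse (P (E - {1..M})) * (inverse (P ({1..M} \<inter> E)) * P ({1..M} \<inter> E))"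
    unfolding 1 2 fps_inverse_mult by (simp only: mult_ac)
  then have "qpoch fps_X M * inverse (qpoch (fps_X ^ 2) M) =
      P ({1..M} - E) * inverse (P (E - {1..M}))"
    unfolding 3 by simp
  moreover have "odd i" if "i \<in> {1..M} - E" for i
  proof
    assume "even i"
    then obtain j where "i = 2 * j" ..
    with that have "i = 2 * Suc (j - 1)" "j - 1 < M" by auto
    then show False using that by (auto simp: E_def)
  qed
  ultimately show ?thesis
    unfolding P_def
    by (auto intro!: alternating_mult alternating_prod alternating_inverse_prod
        alternating_1_minus_X_power alternating_inverse_1_minus_X_power simp: E_def)
qed

lemma c3_sign_2: "c3 2 n * c3 2 (n + 2) \<ge> 0"
proof -
  have "0 \<le> (- 1) ^ k * c3 2 k" for k
  proof -
    have "c3 2 k = fps_nth ((qpoch fps_X (Suc k) * inverse (qpoch (fps_X ^ 2) (Suc k))) ^ 3) k"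
      unfolding power_mult_distrib fps_inverse_power [symmetric] by (rule c3_eq) auto
    then show ?thesis
      using alternating_power[OF alternating_qpoch_div] by (simp add: alternating_def)
  qed
  \<comment> \<open>The indices have the same parity, so the two signs multiply to one.\<close>
  from mult_nonneg_nonneg[OF this[of n] this[of "n + 2"]] show ?thesis
    by (simp add: power_add mult_ac flip: power_mult_distrib)
qed

theorem theorem1p9:
  fixes p n :: nat
  assumes "prime p"
  shows "c3 p n * c3 p (n + p) \<ge> 0"
proof (cases "odd p")
  case True
  with assms show ?thesis by (rule c3_sign_odd)
next
  case False
  then have "p = 2" using assms primes_dvd_imp_eq two_is_prime_nat by blast
  then show ?thesis using c3_sign_2 by simp
qed

end
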